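(* Let $n\ge1$ and let $f:\mathbb{R}\to\mathbb{R}$ be non-negative, decreasing and right-continuous. For $u\in\mathcal{C}^n$ set $$\mu(u)=\int_{\mathrm{dom}(u)}f(u(x))\,dx .$$ Then: (i) $\mu$ is well defined (i.e. $\mu(u)\in\mathbb{R}$ for every $u\in\mathcal{C}^n$) if and only if $\int_0^\infty t^{n-1}f(t)\,dt<\infty$. Moreover, when this condition holds: (ii) $\mu$ is a valuation on $\mathcal{C}^n$, and it is rigid motion invariant, simple and decreasing; (iii) $\mu$ is $n$-homogeneous; (iv) $\mu$ is m-continuous.
   Context: $\mathcal{C}^n$ is the set of all convex, lower semi-continuous functions $u:\mathbb{R}^n\to\mathbb{R}\cup\{\infty\}$ with $\lim_{|x|\to\infty}u(x)=\infty$; it contains the function $\boldsymbol{\infty}$ identically equal to $\infty$. $\mathrm{dom}(u)=\{x: u(x)<\infty\}$. $u\vee v$ and $u\wedge v$ denote pointwise maximum and minimum. A valuation on $\mathcal{C}^n$ is a map $\mu:\mathcal{C}^n\to\mathbb{R}$ with $\mu(\boldsymbol{\infty})=0$ and $\mu(u\vee v)+\mu(u\wedge v)=\mu(u)+\mu(v)$ for all $u,v\in\mathcal{C}^n$ such that $u\wedge v\in\mathcal{C}^n$. It is: - rigid motion invariant if $\mu(u\circ T)=\mu(u)$ for all $u\in\mathcal{C}^n$ and all rigid motions $T$ (maps $T(x)=Rx+x_0$ with $R\in\mathbf{O}(n)$, $x_0\in\mathbb{R}^n$); - decreasing if $\mu(u)\le\mu(v)$ whenever $u\ge v$ pointwise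 in $\mathbb{R}^n$; - m-continuous if $\lim_{i\to\infty}\mu(u_i)=\mu(u)$ whenever $u,u_i\in\mathcal{C}^n$ satisfy $u_i\ge u_{i+1}\ge u$ in $\mathbb{R}^n$ for every $i$ and $u_i(x)\to u(x)$ for every $x$ in the relative interior of $\mathrm{dom}(u)$; - simple if $\mu(u)=0$ for every $u\in\mathcal{C}^n$ such that $\mathrm{dom}(u)$ has no interior points; - $n$-homogeneous if $\mu(u_\lambda)=\lambda^n\mu(u)$ for all $u\in\mathcal{C}^n$, $\lambda>0$, where $u_\lambda(x)=u(x/\lambda)$. "Decreasing" for functions on $\mathbb{R}$ means non-increasing; $dx$ is Lebesgue measure. *)

theory Defs
  imports "HOL-Analysis.Analysis"
begin

text \<open>
  Functions with values in the reals extended by plus infinity are modelled as functions into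
  \<^typ>\<open>ereal\<close> that omit the value \<open>- \<infinity>\<close>. The dimension is \<open>n = CARD('n)\<close>, hence \<open>n \<ge> 1\<close>.
\<close>

definition edom :: "('a \<Rightarrow> ereal) \<Rightarrow> 'a set" where
  "edom u = {x. u x < \<infinity>}"

text \<open>The library predicate \<^const>\<open>convex_on\<close> only covers real-valued functions.\<close>

definition econvex :: "(real ^ 'n \<Rightarrow> ereal) \<Rightarrow> bool" where
  "econvex u \<longleftrightarrow>
     (\<forall>x y t. 0 < t \<longrightarrow> t < 1 \<longrightarrow>
        u ((1 - t) *\<^sub>R x + t *\<^sub>R y) \<le> ereal (1 - t) * u x + ereal t * u y)"

definition lower_semicontinuous :: "('a :: topological_space \<Rightarrow> ereal) \<Rightarrow> bool" where
  "lower_semicontinuous u \<longleftrightarrow> (\<forall>x. u x \<le> Liminf (at x) u)"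

definition coercive_convex :: "(real ^ 'n \<Rightarrow> ereal) set" where
  "coercive_convex =
     {u. (\<forall>x. u x \<noteq> - \<infinity>) \<and> econvex u \<and> lower_semicontinuous u \<and>
         (u \<longlongrightarrow> \<infinity>) at_infinity}"

text \<open>
  A functional on \<^const>\<open>coercive_convex\<close> is represented by a total function; all notions below
  only look at its values on \<^const>\<open>coercive_convex\<close>.
\<close>

definition valuation :: "((real ^ 'n \<Rightarrow> ereal) \<Rightarrow> real) \<Rightarrow> bool" where
  "valuation \<mu> \<longleftrightarrow>
     \<mu> (\<lambda>x. \<infinity>) = 0 \<and>
     (\<forall>u\<in>coercive_convex. \<forall>v\<in>coercive_convex.
        (\<lambda>x. min (u x) (v x)) \<in> coercive_convex \<longrightarrow>
        \<mu> (\<lambda>x. max (u x) (v x)) + \<mu> (\<lambda>x. min (u x) (v x)) = \<mu> u + \<mu> v)"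

definition rigid_motion :: "(real ^ 'n \<Rightarrow> real ^ 'n) \<Rightarrow> bool" where
  "rigid_motion T \<longleftrightarrow> (\<exists>R x\<^sub>0. orthogonal_matrix R \<and> T = (\<lambda>x. R *v x + x\<^sub>0))"

definition rigid_motion_invariant :: "((real ^ 'n \<Rightarrow> ereal) \<Rightarrow> real) \<Rightarrow> bool" where
  "rigid_motion_invariant \<mu> \<longleftrightarrow>
     (\<forall>u\<in>coercive_convex. \<forall>T. rigid_motion T \<longrightarrow> \<mu> (u \<circ> T) = \<mu> u)"

definition decreasing_functional :: "((real ^ 'n \<Rightarrow> ereal) \<Rightarrow> real) \<Rightarrow> bool" where
  "decreasing_functional \<mu> \<longleftrightarrow>
     (\<forall>u\<in>coercive_convex. \<forall>v\<in>coercive_convex. (\<forall>x. u x \<ge> v x) \<longrightarrow> \<mu> u \<le> \<mu> v)"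

definition m_continuous :: "((real ^ 'n \<Rightarrow> ereal) \<Rightarrow> real) \<Rightarrow> bool" where
  "m_continuous \<mu> \<longleftrightarrow>
     (\<forall>u\<in>coercive_convex. \<forall>U :: nat \<Rightarrow> real ^ 'n \<Rightarrow> ereal.
        (\<forall>i. U i \<in> coercive_convex) \<longrightarrow>
        (\<forall>i x. U i x \<ge> U (Suc i) x \<and> U (Suc i) x \<ge> u x) \<longrightarrow>
        (\<forall>x\<in>rel_interior (edom u). (\<lambda>i. U i x) \<longlonglongrightarrow> u x) \<longrightarrow>
        (\<lambda>i. \<mu> (U i)) \<longlonglongrightarrow> \<mu> u)"

definition simple_functional :: "((real ^ 'n \<Rightarrow> ereal) \<Rightarrow> real) \<Rightarrow> bool" where
  "simple_functional \<mu> \<longleftrightarrow> (\<forall>u\<in>coercive_convex. interior (edom u) = {} \<longrightarrow> \<mu> u = 0)"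

definition homogeneous_functional :: "nat \<Rightarrow> ((real ^ 'n \<Rightarrow> ereal) \<Rightarrow> real) \<Rightarrow> bool" where
  "homogeneous_functional k \<mu> \<longleftrightarrow>
     (\<forall>u\<in>coercive_convex. \<forall>c>0. \<mu> (\<lambda>x. u (x /\<^sub>R c)) = c ^ k * \<mu> u)"

text \<open>
  On \<^term>\<open>edom u\<close>, for \<open>u\<close> in \<^const>\<open>coercive_convex\<close>, the value \<open>u x\<close> is a real number, so
  \<^const>\<open>real_of_ereal\<close> does not lose information there. Since the Bochner
  integral of a non-integrable function is 0, that the integral is well defined as a real number
  is stated separately, by \<open>integral_wf\<close>.
\<close>

definition integral_wf :: "(real \<Rightarrow> real) \<Rightarrow> (real ^ 'n \<Rightarrow> ereal) \<Rightarrow> bool" where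
  "integral_wf f u \<longleftrightarrow> set_integrable lebesgue (edom u) (\<lambda>x. f (real_of_ereal (u x)))"

definition integral_functional :: "(real \<Rightarrow> real) \<Rightarrow> (real ^ 'n \<Rightarrow> ereal) \<Rightarrow> real" where
  "integral_functional f u = (LINT x:edom u|lebesgue. f (real_of_ereal (u x)))"

end

theory Submission
  imports Defs
begin

text \<open>
  A coercive convex \<open>u\<close> dominates some \<open>a * norm x - b\<close> with \<open>a > 0\<close>, so \<open>f (u x)\<close> is dominated by
  a constant on a ball plus \<open>f (a / 2 * norm x)\<close>; in polar coordinates the latter is integrable iff
  the moment condition holds, and \<open>u = norm\<close> shows that the condition is necessary. The valuation
  property and monotonicity hold pointwise, the invariances come from Lebesgue measure, and
  m-continuity is dominated convergence off the frontier of the convex domain, which is a null set.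
\<close>

text \<open>
  The linear change of variables in the library needs a well-ordered index type, which is not
  available here; for isometries it can be replaced by a Vitali covering with balls, whose preimages
  are balls of the same radius.
\<close>

lemma isometry_emeasure_vimage_ge:
  fixes T S :: "'a::euclidean_space \<Rightarrow> 'a"
  assumes iso: "\<And>x y. dist (T x) (T y) = dist x y"
    and TS: "\<And>x. T (S x) = x" and "open A"
  shows "emeasure lborel A \<le> emeasure lborel (T -` A)"
proof -
  have cont: "continuous_on UNIV T"
    unfolding continuous_on_iff using iso by metis
  define K where "K = {p::'a \<times> real. 0 < snd p \<and> ball (fst p) (snd p) \<subseteq> A}"
  have K: "\<exists>i. i \<in> K \<and> x \<in> ball (fst i) (snd i) \<and> snd i < d" if "x \<in> A" "0 < d" for x d
  proof -
    obtain e where e: "e > 0" "ball x e \<subseteq> A"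
      using \<open>open A\<close> \<open>x \<in> A\<close> openE by blast
    have "ball x (min e (d / 2)) \<subseteq> A"
      using e(2) by auto
    then show ?thesis
      using e that by (intro exI[of _ "(x, min e (d / 2))"]) (auto simp: K_def)
  qed
  obtain C where C: "countable C" "C \<subseteq> K"
    "pairwise (\<lambda>i j. disjnt (ball (fst i) (snd i)) (ball (fst j) (snd j))) C"
    "negligible (A - (\<Union>i\<in>C. ball (fst i) (snd i)))"
    by (rule Vitali_covering_theorem_balls[OF K])
  define B where "B i = ball (fst i) (snd i)" for i :: "'a \<times> real"
  have B_meas: "B i \<in> sets borel" for i
    by (simp add: B_def)
  have disj: "disjoint_family_on B C"
    using C(3) unfolding disjoint_family_on_def pairwise_def disjnt_def B_def by blast
  have ball: "T -` B i = ball (S (fst i)) (snd i)" for i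
    using iso[of "S (fst i)"] TS by (auto simp: B_def)
  have "A - (\<Union>i\<in>C. B i) \<in> null_sets lborel"
  proof (subst null_sets_completion_iff[symmetric])
    have "open (\<Union>i\<in>C. B i)"
      by (auto simp: B_def)
    then show "A - (\<Union>i\<in>C. B i) \<in> sets lborel"
      using \<open>open A\<close> by auto
    show "A - (\<Union>i\<in>C. B i) \<in> null_sets lebesgue"
      using C(4) by (simp add: B_def negligible_iff_null_sets)
  qed
  then have "emeasure lborel A = emeasure lborel ((\<Union>i\<in>C. B i) \<union> (A - (\<Union>i\<in>C. B i)))"
    using C(2) by (intro arg_cong[where f = "emeasure lborel"]) (auto simp: K_def B_def)
  also have "\<dots> = emeasure lborel (\<Union>i\<in>C. B i)"
    using \<open>A - (\<Union>i\<in>C. B i) \<in> null_sets lborel\<close>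
    by (intro emeasure_Un_null_set) (auto simp: B_def intro!: borel_open)
  also have "\<dots> = (\<integral>\<^sup>+ i. emeasure lborel (B i) \<partial>count_space C)"
    using C(1) disj by (intro emeasure_UN_countable) (simp_all add: B_meas)
  also have "\<dots> = (\<integral>\<^sup>+ i. emeasure lborel (T -` B i) \<partial>count_space C)"
    using C(2) unfolding ball
    by (intro nn_integral_cong) (auto simp: B_def K_def emeasure_ball)
  also have "\<dots> = emeasure lborel (\<Union>i\<in>C. T -` B i)"
  proof (rule emeasure_UN_countable[symmetric])
    show "disjoint_family_on (\<lambda>i. T -` B i) C"
      using disj by (fastforce simp: disjoint_family_on_def)
  qed (simp_all add: C(1) ball)
  also have "\<dots> \<le> emeasure lborel (T -` A)"
    using C(2) open_vimage[OF \<open>open A\<close> cont]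
    by (intro emeasure_mono) (auto simp: B_def K_def)
  finally show ?thesis .
qed

lemma lborel_distr_isometry:
  fixes T S :: "'a::euclidean_space \<Rightarrow> 'a"
  assumes iso: "\<And>x y. dist (T x) (T y) = dist x y"
    and TS: "\<And>x. T (S x) = x" and ST: "\<And>x. S (T x) = x"
  shows "distr lborel borel T = lborel"
proof (rule lborel_eqI[symmetric])
  fix l u :: 'a
  assume lu: "\<And>b. b \<in> Basis \<Longrightarrow> l \<bullet> b \<le> u \<bullet> b"
  have cont: "continuous_on UNIV T"
    unfolding continuous_on_iff using iso by metis
  have iso': "dist (S x) (S y) = dist x y" for x y
    using iso[of "S x" "S y"] TS by simp
  have "S -` (T -` box l u) = box l u"
    using TS by auto
  then have "emeasure lborel (T -` box l u) = emeasure lborel (box l u)"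
    using isometry_emeasure_vimage_ge[OF iso TS, of "box l u"]
      isometry_emeasure_vimage_ge[OF iso' ST, of "T -` box l u"]
      open_vimage[OF open_box cont, of l u]
    by (intro antisym) (auto simp: open_box)
  then show "emeasure (distr lborel borel T) (box l u) = (\<Prod>b\<in>Basis. (u - l) \<bullet> b)"
    using cont lu by (subst emeasure_distr) (auto intro: borel_measurable_continuous_onI)
qed simp

lemma lborel_distr_rigid_motion:
  fixes T :: "real ^ 'n \<Rightarrow> real ^ 'n"
  assumes "rigid_motion T"
  shows "distr lborel borel T = lborel"
proof -
  obtain R c where R: "orthogonal_matrix R" and T: "T = (\<lambda>x. R *v x + c)"
    using assms unfolding rigid_motion_def by blast
  have *: "R *v (transpose R *v x) = x" "transpose R *v (R *v x) = x" for x
    using R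
    by (simp_all add: matrix_vector_mul_assoc orthogonal_matrix_def
        del: transpose_matrix_vector)
  have ot: "orthogonal_transformation ((*v) R)"
    using R by (simp add: orthogonal_transformation_matrix)
  have "dist (T x) (T y) = dist x y" for x y
    using orthogonal_transformation_norm[OF ot, of "x - y"]
    by (simp add: T dist_norm matrix_vector_mult_diff_distrib)
  then show ?thesis
    by (rule lborel_distr_isometry[where S = "\<lambda>x. transpose R *v (x - c)"])
      (simp_all add: T * del: transpose_matrix_vector)
qed

lemma distr_lborel_norm:
  "distr lborel borel (norm :: 'a::euclidean_space \<Rightarrow> real) =
    density lborel (\<lambda>t. ennreal (real DIM('a) * unit_ball_vol DIM('a) * t ^ (DIM('a) - 1)) * indicator {0..} t)"
    (is "?M = ?N")
proof (rule measure_eqI_generator_eq)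
  let ?E = "range (\<lambda>a::real. {..a})"
  let ?c = "real DIM('a) * unit_ball_vol DIM('a)"
  show "Int_stable ?E"
    by (auto simp: Int_stable_def)
  show "?E \<subseteq> Pow UNIV" "sets ?M = sigma_sets UNIV ?E" "sets ?N = sigma_sets UNIV ?E"
    by (simp_all add: borel_eq_atMost)
  have M: "emeasure ?M {..a} = ennreal (unit_ball_vol DIM('a) * max 0 a ^ DIM('a))" for a
  proof -
    have "emeasure ?M {..a} = emeasure lborel (norm -` {..a} :: 'a set)"
      by (subst emeasure_distr) auto
    also have "\<dots> = emeasure lborel (if a < 0 then {} else cball 0 a :: 'a set)"
      by (rule arg_cong[where f = "emeasure lborel"])
        (auto simp: vimage_def dest: order_trans[OF norm_ge_zero])
    also have "\<dots> = ennreal (unit_ball_vol DIM('a) * max 0 a ^ DIM('a))"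
      by (simp add: emeasure_cball)
    finally show ?thesis .
  qed
  have N: "emeasure ?N {..a} = ennreal (unit_ball_vol DIM('a) * max 0 a ^ DIM('a))" for a
  proof (cases "a < 0")
    case True
    then have "emeasure ?N {..a} = integral\<^sup>N lborel (\<lambda>_::real. 0)"
      by (subst emeasure_density, simp, simp, intro nn_integral_cong)
        (auto split: split_indicator)
    then show ?thesis
      using True by simp
  next
    case False
    have "emeasure ?N {..a} = (\<integral>\<^sup>+t. ennreal (?c * t ^ (DIM('a) - 1)) * indicator {0..a} t \<partial>lborel)"
      by (subst emeasure_density, simp, simp, rule nn_integral_cong)
        (auto split: split_indicator)
    also have "\<dots> = unit_ball_vol DIM('a) * a ^ DIM('a) - unit_ball_vol DIM('a) * 0 ^ DIM('a)"
      using False by (intro nn_integral_FTC_Icc) (auto intro!: derivative_eq_intros)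
    finally show ?thesis
      using False by simp
  qed
  show "emeasure ?M X = emeasure ?N X" if "X \<in> ?E" for X
    using that by (elim rangeE) (simp only: M N)
  show "range (\<lambda>i::nat. {..real i}) \<subseteq> ?E" "emeasure ?M {..real i} \<noteq> \<infinity>" for i
    by (auto simp: M)
  show "(\<Union>i::nat. {..real i}) = UNIV"
    using real_arch_simple by (auto)
qed

lemma nn_integral_lborel_norm:
  fixes h :: "real \<Rightarrow> ennreal"
  assumes [measurable]: "h \<in> borel_measurable borel"
  shows "(\<integral>\<^sup>+ x. h (norm (x :: 'a::euclidean_space)) \<partial>lborel) =
    ennreal (real DIM('a) * unit_ball_vol DIM('a)) *
      (\<integral>\<^sup>+ t\<in>{0..}. ennreal (t ^ (DIM('a) - 1)) * h t \<partial>lborel)"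
proof -
  have "(\<integral>\<^sup>+ x. h (norm (x :: 'a)) \<partial>lborel) = (\<integral>\<^sup>+ t. h t \<partial>distr lborel borel (norm :: 'a \<Rightarrow> real))"
    by (subst nn_integral_distr) auto
  also have "\<dots> = (\<integral>\<^sup>+ t. ennreal (real DIM('a) * unit_ball_vol DIM('a)) *
      (ennreal (t ^ (DIM('a) - 1)) * h t * indicator {0..} t) \<partial>lborel)"
    unfolding distr_lborel_norm
    by (subst nn_integral_density, simp, simp, rule nn_integral_cong)
      (auto split: split_indicator simp: ennreal_mult' mult_ac)
  also have "\<dots> = ennreal (real DIM('a) * unit_ball_vol DIM('a)) *
      (\<integral>\<^sup>+ t\<in>{0..}. ennreal (t ^ (DIM('a) - 1)) * h t \<partial>lborel)"
    by (rule nn_integral_cmult) simp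
  finally show ?thesis .
qed

lemma
  fixes g :: "'a::euclidean_space \<Rightarrow> real"
  assumes [measurable]: "g \<in> borel_measurable borel" and c: "c > 0"
  shows integrable_lborel_scaleR: "integrable lborel (\<lambda>x. g (c *\<^sub>R x)) \<longleftrightarrow> integrable lborel g"
    and integral_lborel_scaleR: "(LINT x|lborel. g x) = c ^ DIM('a) * (LINT x|lborel. g (c *\<^sub>R x))"
proof -
  have eq: "lborel = density (distr lborel borel (\<lambda>x::'a. c *\<^sub>R x)) (\<lambda>_. \<bar>c\<bar> ^ DIM('a))"
    using lborel_affine[of c 0] c by simp
  have "integrable lborel g \<longleftrightarrow> integrable (distr lborel borel (\<lambda>x::'a. c *\<^sub>R x)) (\<lambda>x. \<bar>c\<bar> ^ DIM('a) *\<^sub>R g x)"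
    by (subst eq, subst integrable_density) (use c in auto)
  also have "\<dots> \<longleftrightarrow> integrable lborel (\<lambda>x. g (c *\<^sub>R x))"
    using c by (subst integrable_distr_eq) auto
  finally show "integrable lborel (\<lambda>x. g (c *\<^sub>R x)) \<longleftrightarrow> integrable lborel g" ..
  have "integral\<^sup>L lborel g = (LINT x|distr lborel borel (\<lambda>x::'a. c *\<^sub>R x). \<bar>c\<bar> ^ DIM('a) *\<^sub>R g x)"
    by (subst eq, subst integral_density) (use c in auto)
  also have "\<dots> = c ^ DIM('a) * (LINT x|lborel. g (c *\<^sub>R x))"
    using c by (subst integral_distr) auto
  finally show "(LINT x|lborel. g x) = c ^ DIM('a) * (LINT x|lborel. g (c *\<^sub>R x))" .
qed

lemma lower_semicontinuous_open_superlevel: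
  assumes "lower_semicontinuous u"
  shows "open {x. c < u x}"
proof (subst open_subopen, clarsimp)
  fix x assume x: "c < u x"
  then have "c < Liminf (at x) u"
    using assms unfolding lower_semicontinuous_def by (meson less_le_trans)
  then have "\<forall>\<^sub>F y in at x. c < u y"
    by (rule less_LiminfD)
  then obtain S where "open S" "x \<in> S" "\<And>y. y \<in> S \<Longrightarrow> y \<noteq> x \<Longrightarrow> c < u y"
    unfolding eventually_at_topological by blast
  with x show "\<exists>T. open T \<and> x \<in> T \<and> T \<subseteq> {x. c < u x}"
    by blast
qed

lemma lower_semicontinuous_borel_measurable:
  "lower_semicontinuous u \<Longrightarrow> u \<in> borel_measurable borel"
  by (rule borel_measurableI_greater) (simp add: lower_semicontinuous_open_superlevel)

lemma lower_semicontinuous_bounded_below: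
  assumes "lower_semicontinuous u" and "\<And>x. u x \<noteq> - \<infinity>" and "compact K"
  obtains L :: real where "\<And>x. x \<in> K \<Longrightarrow> ereal L < u x"
proof -
  have cover: "K \<subseteq> (\<Union>k::nat. {x. ereal (- real k) < u x})"
  proof
    fix x
    obtain k :: nat where "ereal (- real k) < u x"
    proof (cases "u x")
      case (real r)
      obtain k :: nat where "- r < real k"
        using reals_Archimedean2 by blast
      then show ?thesis
        using real by (intro that[of k]) auto
    qed (use assms(2)[of x] that[of 0] in auto)
    then show "x \<in> (\<Union>k::nat. {x. ereal (- real k) < u x})"
      by blast
  qed
  obtain I where I: "finite I" "K \<subseteq> (\<Union>k\<in>I. {x. ereal (- real k) < u x})"
    using compactE_image[OF \<open>compact K\<close> lower_semicontinuous_open_superlevel[OF assms(1)] cover]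
    by metis
  show ?thesis
  proof (rule that[of "- real (Max (insert 0 I))"])
    fix x assume "x \<in> K"
    then obtain k where k: "k \<in> I" "ereal (- real k) < u x"
      using I(2) by blast
    then have "k \<le> Max (insert 0 I)"
      using I(1) by simp
    then have "ereal (- real (Max (insert 0 I))) \<le> ereal (- real k)"
      by simp
    then show "ereal (- real (Max (insert 0 I))) < u x"
      using k(2) by (rule le_less_trans)
  qed
qed

lemma convex_edom:
  assumes "econvex u"
  shows "convex (edom u)"
  unfolding convex_alt
proof (intro ballI allI impI)
  fix x y and t :: real
  assume "x \<in> edom u" "y \<in> edom u" "0 \<le> t \<and> t \<le> 1"
  then have *: "u x \<noteq> \<infinity>" "u y \<noteq> \<infinity>" "0 \<le> t" "t \<le> 1"
    by (auto simp: edom_def)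
  show "(1 - t) *\<^sub>R x + t *\<^sub>R y \<in> edom u"
  proof (cases "t = 0 \<or> t = 1")
    case False
    then have "u ((1 - t) *\<^sub>R x + t *\<^sub>R y) \<le> ereal (1 - t) * u x + ereal t * u y"
      using assms * by (simp add: econvex_def)
    also have "\<dots> < \<infinity>"
      using * by (cases "u x"; cases "u y") (auto)
    finally show ?thesis by (simp add: edom_def)
  qed (use * in \<open>auto simp: edom_def\<close>)
qed

text \<open>
  If \<open>u > u x0 + 1\<close> on the sphere of radius \<open>R\<close> about \<open>x0\<close>, convexity forces growth at rate at
  least \<open>1 / R\<close> along every ray from \<open>x0\<close> beyond that sphere.
\<close>

lemma coercive_convex_linear_lower_bound:
  fixes u :: "real ^ 'n \<Rightarrow> ereal"
  assumes "u \<in> coercive_convex"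
  obtains a b :: real where "0 < a" "0 \<le> b" "\<And>x. ereal (a * norm x - b) \<le> u x"
proof (cases "\<exists>x. u x < \<infinity>")
  case False
  then show ?thesis
    using that[of 1 0] by auto
next
  case True
  have u: "\<And>x. u x \<noteq> - \<infinity>" "econvex u" "lower_semicontinuous u" "(u \<longlongrightarrow> \<infinity>) at_infinity"
    using assms by (auto simp: coercive_convex_def)
  obtain x0 m where m: "u x0 = ereal m"
    using True u(1) by (metis ereal_cases less_irrefl)
  have "\<forall>\<^sub>F x in at_infinity. ereal (m + 1) < u x"
    using u(4) by (simp add: tendsto_PInfty)
  then obtain R0 where R0: "\<And>x. R0 \<le> norm x \<Longrightarrow> ereal (m + 1) < u x"
    unfolding eventually_at_infinity by blast
  define R where "R = max R0 1 + norm x0"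
  have R: "0 < R" "R0 + norm x0 \<le> R"
    unfolding R_def by (simp_all add: add_pos_nonneg)
  have outer: "ereal (m + norm (x - x0) / R) \<le> u x" if "R \<le> norm (x - x0)" for x
  proof (cases "u x")
    case (real r)
    define t where "t = R / norm (x - x0)"
    have d: "0 < norm (x - x0)"
      using R that by linarith
    have t: "0 < t" "t \<le> 1"
      unfolding t_def using R that d by (simp_all only: divide_pos_pos divide_le_eq_1_pos)
    define y where "y = (1 - t) *\<^sub>R x0 + t *\<^sub>R x"
    have "y - x0 = t *\<^sub>R (x - x0)"
      by (simp add: y_def algebra_simps)
    then have "norm (y - x0) = R"
      using R that t by (auto simp: t_def)
    then have "R0 \<le> norm y"
      using R norm_triangle_ineq4[of y x0] by linarith
    then have "ereal (m + 1) < u y"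
      by (rule R0)
    also have "u y \<le> ereal (1 - t) * u x0 + ereal t * u x"
    proof (cases "t = 1")
      case False
      then show ?thesis
        using u(2) t unfolding econvex_def y_def by auto
    qed (simp add: y_def zero_ereal_def[symmetric] one_ereal_def[symmetric])
    finally have "1 < t * (r - m)"
      by (simp add: m real algebra_simps)
    then have "norm (x - x0) / R < r - m"
      using R d by (simp add: t_def field_simps)
    then show ?thesis
      by (simp add: real)
  qed (use u(1)[of x] in auto)
  obtain L where L: "\<And>x. x \<in> cball x0 R \<Longrightarrow> ereal L < u x"
    using lower_semicontinuous_bounded_below[OF u(3,1) compact_cball] by metis
  define b where "b = norm x0 / R + 1 + \<bar>L\<bar> + \<bar>m\<bar>"
  show ?thesis
  proof (rule that[of "1 / R" b])
    show "0 < 1 / R" "0 \<le> b"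
      using R by (auto simp: b_def)
    fix x
    have tri: "norm x / R \<le> norm (x - x0) / R + norm x0 / R"
      using R norm_triangle_sub[of x x0] by (simp add: divide_right_mono flip: add_divide_distrib)
    show "ereal (1 / R * norm x - b) \<le> u x"
    proof (cases "R \<le> norm (x - x0)")
      case True
      have "ereal (1 / R * norm x - b) \<le> ereal (m + norm (x - x0) / R)"
        using tri by (simp add: b_def)
      then show ?thesis
        using outer[OF True] by (rule order_trans)
    next
      case False
      then have "norm (x - x0) / R \<le> 1"
        using R by simp
      then have "ereal (1 / R * norm x - b) \<le> ereal L"
        using tri by (simp add: b_def)
      moreover have "ereal L < u x"
        using False by (intro L) (simp add: dist_norm norm_minus_commute)
      ultimately show ?thesis
        by (meson le_less_trans less_imp_le)
    qed
  qed
qed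

lemma norm_coercive_convex: "(\<lambda>x::real ^ 'n. ereal (norm x)) \<in> coercive_convex"
  unfolding coercive_convex_def
proof (intro CollectI conjI allI)
  show "econvex (\<lambda>x::real ^ 'n. ereal (norm x))"
    unfolding econvex_def
  proof (intro allI impI)
    fix x y :: "real ^ 'n" and t :: real
    assume "0 < t" "t < 1"
    then show "ereal (norm ((1 - t) *\<^sub>R x + t *\<^sub>R y)) \<le>
        ereal (1 - t) * ereal (norm x) + ereal t * ereal (norm y)"
      using norm_triangle_ineq[of "(1 - t) *\<^sub>R x" "t *\<^sub>R y"] by simp
  qed
  show "lower_semicontinuous (\<lambda>x::real ^ 'n. ereal (norm x))"
    unfolding lower_semicontinuous_def
  proof
    fix x :: "real ^ 'n"
    have "((\<lambda>x. ereal (norm x)) \<longlongrightarrow> ereal (norm x)) (at x)"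
      by (intro tendsto_intros)
    then have "Liminf (at x) (\<lambda>x. ereal (norm x)) = ereal (norm x)"
      by (intro lim_imp_Liminf) simp_all
    then show "ereal (norm x) \<le> Liminf (at x) (\<lambda>x. ereal (norm x))"
      by simp
  qed
  show "((\<lambda>x::real ^ 'n. ereal (norm x)) \<longlongrightarrow> \<infinity>) at_infinity"
    unfolding tendsto_PInfty eventually_at_infinity
  proof
    fix r :: real
    show "\<exists>b. \<forall>x::real ^ 'n. b \<le> norm x \<longrightarrow> ereal r < ereal (norm x)"
      by (intro exI[of _ "r + 1"]) auto
  qed
qed simp

definition dom_comp :: "(real \<Rightarrow> real) \<Rightarrow> (real ^ 'n \<Rightarrow> ereal) \<Rightarrow> real ^ 'n \<Rightarrow> real" where
  "dom_comp f u x = (if u x < \<infinity> then f (real_of_ereal (u x)) else 0)"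

lemma dom_comp_eq: "indicat_real (edom u) x *\<^sub>R f (real_of_ereal (u x)) = dom_comp f u x"
  by (simp add: dom_comp_def edom_def)

lemma dom_comp_compose: "dom_comp f (\<lambda>x. u (g x)) = (\<lambda>x. dom_comp f u (g x))"
  by (simp add: dom_comp_def fun_eq_iff)

lemma integral_functional_lebesgue: "integral_functional f u = (LINT x|lebesgue. dom_comp f u x)"
  by (simp only: integral_functional_def set_lebesgue_integral_def dom_comp_eq)

lemma dom_comp_max_min:
  "dom_comp f (\<lambda>x. max (u x) (v x)) x + dom_comp f (\<lambda>x. min (u x) (v x)) x =
    dom_comp f u x + dom_comp f v x"
  by (cases "u x \<le> v x") (auto simp: dom_comp_def max_def min_def)

locale nonneg_antimono =
  fixes f :: "real \<Rightarrow> real"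
  assumes nonneg: "\<And>t. 0 \<le> f t"
    and decreasing: "antimono f"
begin

lemma borel_measurable_f [measurable]: "f \<in> borel_measurable borel"
proof -
  have "(\<lambda>x. - f x) \<in> borel_measurable borel"
    using decreasing by (intro borel_measurable_mono) (auto simp: monotone_def)
  then show ?thesis
    by simp
qed

lemma dom_comp_nonneg: "0 \<le> dom_comp f u x"
  by (simp add: dom_comp_def nonneg)

lemma dom_comp_antimono:
  assumes "v x \<le> u x" "v x \<noteq> - \<infinity>"
  shows "dom_comp f u x \<le> dom_comp f v x"
  using assms decreasing nonneg
  by (cases "u x"; cases "v x") (auto simp: dom_comp_def monotone_def)

lemma dom_comp_measurable [measurable (raw)]:
  assumes "lower_semicontinuous u"
  shows "dom_comp f u \<in> borel_measurable borel"
proof -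
  note [measurable] = lower_semicontinuous_borel_measurable[OF assms]
  show ?thesis
    unfolding dom_comp_def[abs_def] by measurable
qed

lemma integral_wf_iff:
  assumes "lower_semicontinuous u"
  shows "integral_wf f u \<longleftrightarrow> integrable lborel (dom_comp f u)"
  unfolding integral_wf_def set_integrable_def dom_comp_eq
  using dom_comp_measurable[OF assms] by (intro integrable_completion) simp

lemma integral_functional_eq:
  assumes "lower_semicontinuous u"
  shows "integral_functional f u = (LINT x|lborel. dom_comp f u x)"
  unfolding integral_functional_lebesgue
  using dom_comp_measurable[OF assms] by (intro integral_completion) simp

lemma integrable_norm_iff:
  "integrable lborel (\<lambda>x::'a::euclidean_space. f (norm x)) \<longleftrightarrow>
    (\<integral>\<^sup>+ t\<in>{0..}. ennreal (t ^ (DIM('a) - 1) * f t) \<partial>lborel) < \<infinity>"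
proof -
  let ?c = "real DIM('a) * unit_ball_vol DIM('a)"
  have vol: "unit_ball_vol (real DIM('a)) \<noteq> 0"
    by (metis unit_ball_vol_pos of_nat_0_le_iff less_irrefl)
  have "integrable lborel (\<lambda>x::'a. f (norm x)) \<longleftrightarrow> (\<integral>\<^sup>+ x. ennreal (f (norm (x::'a))) \<partial>lborel) < \<infinity>"
    using nonneg by (simp add: integrable_iff_bounded)
  also have "(\<integral>\<^sup>+ x. ennreal (f (norm (x::'a))) \<partial>lborel) =
      ennreal ?c * (\<integral>\<^sup>+ t\<in>{0..}. ennreal (t ^ (DIM('a) - 1)) * ennreal (f t) \<partial>lborel)"
    by (rule nn_integral_lborel_norm) simp
  also have "(\<integral>\<^sup>+ t\<in>{0..}. ennreal (t ^ (DIM('a) - 1)) * ennreal (f t) \<partial>lborel) =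
      (\<integral>\<^sup>+ t\<in>{0..}. ennreal (t ^ (DIM('a) - 1) * f t) \<partial>lborel)"
    by (rule nn_integral_cong) (auto split: split_indicator simp: ennreal_mult nonneg)
  also have "ennreal ?c * \<dots> < \<infinity> \<longleftrightarrow> \<dots> < \<infinity>"
    by (auto simp: vol ennreal_mult_less_top less_top[symmetric] ennreal_mult_eq_top_iff)
  finally show ?thesis .
qed

lemma integrable_dom_comp:
  fixes u :: "real ^ 'n \<Rightarrow> ereal"
  assumes int: "integrable lborel (\<lambda>x::real ^ 'n. f (norm x))" and u: "u \<in> coercive_convex"
  shows "integrable lborel (dom_comp f u)"
proof -
  obtain a b where a: "0 < a" and b: "0 \<le> b" and ab: "\<And>x. ereal (a * norm x - b) \<le> u x"
    using coercive_convex_linear_lower_bound[OF u] by metis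
  have lsc: "lower_semicontinuous u"
    using u by (simp add: coercive_convex_def)
  let ?g = "\<lambda>x::real ^ 'n. f (- b) * indicator (cball 0 (2 * b / a)) x + f (norm ((a / 2) *\<^sub>R x))"
  have "integrable lborel ?g"
    using a int by (intro Bochner_Integration.integrable_add
        integrable_lborel_scaleR[where g = "\<lambda>x. f (norm x)", THEN iffD2] integrable_mult_right)
      (auto simp: emeasure_cball b)
  moreover have "norm (dom_comp f u x) \<le> norm (?g x)" for x
  proof -
    have "dom_comp f u x \<le> dom_comp f (\<lambda>x. ereal (a * norm x - b)) x"
      using ab by (intro dom_comp_antimono) auto
    also have "\<dots> = f (a * norm x - b)"
      by (simp add: dom_comp_def)
    also have "\<dots> \<le> ?g x"
    proof (cases "norm x \<le> 2 * b / a")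
      case True
      have "f (a * norm x - b) \<le> f (- b)"
        using decreasing a by (auto simp: monotone_def)
      then show ?thesis
        using True nonneg[of "norm ((a / 2) *\<^sub>R x)"] by simp
    next
      case False
      then have "a / 2 * norm x \<le> a * norm x - b"
        using a by (simp add: field_simps)
      then have "f (a * norm x - b) \<le> f (norm ((a / 2) *\<^sub>R x))"
        using decreasing a by (auto simp: monotone_def)
      then show ?thesis
        using False by simp
    qed
    finally show ?thesis
      using dom_comp_nonneg[of u x] by simp
  qed
  moreover have "dom_comp f u \<in> borel_measurable lborel"
    using dom_comp_measurable[OF lsc] by simp
  ultimately show ?thesis
    by (blast intro: Bochner_Integration.integrable_bound)
qed

end

lemma AE_rel_interior_edom:
  fixes u :: "real ^ 'n \<Rightarrow> ereal"
  assumes "econvex u"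
  shows "AE x in lborel. x \<in> edom u \<longrightarrow> x \<in> rel_interior (edom u)"
proof -
  note conv = convex_edom[OF assms]
  have "negligible (edom u - rel_interior (edom u))"
  proof (cases "interior (edom u) = {}")
    case True
    then have "negligible (edom u)"
      using negligible_convex_interior[OF conv] by simp
    then show ?thesis
      by (rule negligible_subset) auto
  next
    case False
    then have "rel_interior (edom u) = interior (edom u)"
      by (rule rel_interior_nonempty_interior)
    then have "edom u - rel_interior (edom u) \<subseteq> frontier (edom u)"
      using closure_subset by (auto simp: frontier_def)
    with negligible_convex_frontier[OF conv] show ?thesis
      by (rule negligible_subset)
  qed
  then have "AE x in lebesgue. x \<in> edom u \<longrightarrow> x \<in> rel_interior (edom u)"
    by (intro AE_I'[of "edom u - rel_interior (edom u)"]) (auto simp: negligible_iff_null_sets)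
  then show ?thesis
    by (simp add: AE_completion_iff)
qed

context nonneg_antimono
begin

lemma integral_functional_valuation:
  assumes int: "\<And>u. u \<in> coercive_convex \<Longrightarrow> integrable lborel (dom_comp f (u :: real ^ 'n \<Rightarrow> ereal))"
  shows "valuation (integral_functional f :: (real ^ 'n \<Rightarrow> ereal) \<Rightarrow> real)"
  unfolding valuation_def
proof (intro conjI ballI impI)
  show "integral_functional f (\<lambda>x::real ^ 'n. \<infinity>) = 0"
    by (simp add: integral_functional_lebesgue dom_comp_def)
  fix u v :: "real ^ 'n \<Rightarrow> ereal"
  assume u: "u \<in> coercive_convex" and v: "v \<in> coercive_convex"
    and min: "(\<lambda>x. min (u x) (v x)) \<in> coercive_convex"
  let ?max = "\<lambda>x. max (u x) (v x)" and ?min = "\<lambda>x. min (u x) (v x)"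
  have eq: "dom_comp f ?max = (\<lambda>x. dom_comp f u x + dom_comp f v x - dom_comp f ?min x)"
    using dom_comp_max_min[of f u v] by (auto simp: algebra_simps)
  have "integrable lborel (dom_comp f ?max)"
    unfolding eq using int u v min
    by (intro Bochner_Integration.integrable_diff Bochner_Integration.integrable_add) auto
  then have "integral_functional f ?max = (LINT x|lborel. dom_comp f ?max x)"
    unfolding integral_functional_lebesgue
    by (intro integral_completion) simp
  also have "\<dots> = (LINT x|lborel. dom_comp f u x) + (LINT x|lborel. dom_comp f v x)
      - (LINT x|lborel. dom_comp f ?min x)"
    unfolding eq using int u v min by simp
  finally show "integral_functional f ?max + integral_functional f ?min =
      integral_functional f u + integral_functional f v"
    using u v min by (simp add: coercive_convex_def integral_functional_eq)
qed

lemma integral_functional_rigid_motion_invariant: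
  "rigid_motion_invariant (integral_functional f :: (real ^ 'n \<Rightarrow> ereal) \<Rightarrow> real)"
  unfolding rigid_motion_invariant_def
proof (intro ballI allI impI)
  fix u :: "real ^ 'n \<Rightarrow> ereal" and T :: "real ^ 'n \<Rightarrow> real ^ 'n"
  assume "u \<in> coercive_convex" and T: "rigid_motion T"
  then have lsc: "lower_semicontinuous u"
    by (simp add: coercive_convex_def)
  note [measurable] = dom_comp_measurable[OF lsc]
  have [measurable]: "T \<in> borel_measurable borel"
    using T unfolding rigid_motion_def
    by (auto intro!: borel_measurable_continuous_onI continuous_intros)
  have "integral_functional f (u \<circ> T) = (LINT x|lebesgue. dom_comp f u (T x))"
    by (simp only: integral_functional_lebesgue dom_comp_compose comp_def)
  also have "\<dots> = (LINT x|lborel. dom_comp f u (T x))"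
    by (rule integral_completion) simp
  also have "\<dots> = (LINT x|distr lborel borel T. dom_comp f u x)"
    by (rule integral_distr[symmetric]) simp_all
  finally show "integral_functional f (u \<circ> T) = integral_functional f u"
    by (simp add: lborel_distr_rigid_motion[OF T] integral_functional_eq[OF lsc])
qed

lemma integral_functional_simple:
  "simple_functional (integral_functional f :: (real ^ 'n \<Rightarrow> ereal) \<Rightarrow> real)"
  unfolding simple_functional_def
proof (intro ballI impI)
  fix u :: "real ^ 'n \<Rightarrow> ereal"
  assume u: "u \<in> coercive_convex" and "interior (edom u) = {}"
  then have "negligible (edom u)"
    using negligible_convex_interior[OF convex_edom] by (auto simp: coercive_convex_def)
  then have "AE x in lebesgue. x \<notin> edom u"
    by (simp add: negligible_iff_null_sets AE_not_in)
  then have "AE x in lebesgue. dom_comp f u x = 0"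
    by eventually_elim (simp add: dom_comp_def edom_def)
  then show "integral_functional f u = 0"
    unfolding integral_functional_lebesgue
    by (rule integral_eq_zero_AE)
qed

lemma integral_functional_decreasing:
  assumes int: "\<And>u. u \<in> coercive_convex \<Longrightarrow> integrable lborel (dom_comp f (u :: real ^ 'n \<Rightarrow> ereal))"
  shows "decreasing_functional (integral_functional f :: (real ^ 'n \<Rightarrow> ereal) \<Rightarrow> real)"
  unfolding decreasing_functional_def
proof (intro ballI impI)
  fix u v :: "real ^ 'n \<Rightarrow> ereal"
  assume uv: "u \<in> coercive_convex" "v \<in> coercive_convex" and le: "\<forall>x. v x \<le> u x"
  then have "(LINT x|lborel. dom_comp f u x) \<le> (LINT x|lborel. dom_comp f v x)"
    using int by (intro integral_mono dom_comp_antimono) (auto simp: coercive_convex_def)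
  then show "integral_functional f u \<le> integral_functional f v"
    using uv by (simp add: coercive_convex_def integral_functional_eq)
qed

lemma integral_functional_homogeneous:
  "homogeneous_functional CARD('n) (integral_functional f :: (real ^ 'n \<Rightarrow> ereal) \<Rightarrow> real)"
  unfolding homogeneous_functional_def
proof (intro ballI allI impI)
  fix u :: "real ^ 'n \<Rightarrow> ereal" and c :: real
  assume "u \<in> coercive_convex" and c: "c > 0"
  then have lsc: "lower_semicontinuous u"
    by (simp add: coercive_convex_def)
  note [measurable] = dom_comp_measurable[OF lsc]
  have "integral_functional f (\<lambda>x. u (x /\<^sub>R c)) = (LINT x|lebesgue. dom_comp f u (x /\<^sub>R c))"
    by (simp only: integral_functional_lebesgue dom_comp_compose comp_def)
  also have "\<dots> = (LINT x|lborel. dom_comp f u (x /\<^sub>R c))"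
    by (rule integral_completion) simp
  also have "\<dots> = c ^ CARD('n) * (LINT x|lborel. dom_comp f u x)"
    using c integral_lborel_scaleR[of "\<lambda>x. dom_comp f u (x /\<^sub>R c)" c] by simp
  finally show "integral_functional f (\<lambda>x. u (x /\<^sub>R c)) = c ^ CARD('n) * integral_functional f u"
    by (simp add: integral_functional_eq[OF lsc])
qed

lemma dom_comp_tendsto:
  assumes rc: "\<And>t. continuous (at_right t) f"
    and lim: "(\<lambda>i. U i x) \<longlonglongrightarrow> u x" and ge: "\<And>i. u x \<le> U i x"
    and fin: "u x \<noteq> - \<infinity>" "u x < \<infinity>"
  shows "(\<lambda>i. dom_comp f (U i) x) \<longlonglongrightarrow> dom_comp f u x"
proof -
  obtain r where r: "u x = ereal r"
    using fin by (cases "u x") auto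
  have "\<forall>\<^sub>F i in sequentially. U i x < \<infinity>"
    using lim fin(2) by (rule order_tendstoD)
  then have ev: "\<forall>\<^sub>F i in sequentially. dom_comp f (U i) x = f (real_of_ereal (U i x)) \<and>
      real_of_ereal (U i x) \<in> {r..}"
  proof eventually_elim
    case (elim i)
    then show ?case
      using ge[of i] r by (cases "U i x") (auto simp: dom_comp_def)
  qed
  have "continuous (at r within {r..}) f"
    using rc[of r] unfolding at_within_Ici_at_right .
  moreover have "(\<lambda>i. real_of_ereal (U i x)) \<longlonglongrightarrow> r"
    using lim r by (auto intro: lim_real_of_ereal)
  ultimately have "(\<lambda>i. f (real_of_ereal (U i x))) \<longlonglongrightarrow> f r"
    using ev by (intro continuous_within_tendsto_compose[of r "{r..}" f]) (auto elim: eventually_mono)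
  moreover have "dom_comp f u x = f r"
    by (simp add: dom_comp_def r)
  moreover have "\<forall>\<^sub>F i in sequentially. f (real_of_ereal (U i x)) = dom_comp f (U i) x"
    using ev by eventually_elim simp
  ultimately show ?thesis
    using Lim_transform_eventually by metis
qed

lemma integral_functional_m_continuous:
  assumes rc: "\<And>t. continuous (at_right t) f"
    and int: "\<And>u. u \<in> coercive_convex \<Longrightarrow> integrable lborel (dom_comp f (u :: real ^ 'n \<Rightarrow> ereal))"
  shows "m_continuous (integral_functional f :: (real ^ 'n \<Rightarrow> ereal) \<Rightarrow> real)"
  unfolding m_continuous_def
proof (intro ballI allI impI)
  fix u :: "real ^ 'n \<Rightarrow> ereal" and U :: "nat \<Rightarrow> real ^ 'n \<Rightarrow> ereal"
  assume u: "u \<in> coercive_convex" and U: "\<forall>i. U i \<in> coercive_convex"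
    and le: "\<forall>i x. U (Suc i) x \<le> U i x \<and> u x \<le> U (Suc i) x"
    and lim: "\<forall>x\<in>rel_interior (edom u). (\<lambda>i. U i x) \<longlonglongrightarrow> u x"
  have u': "\<And>x. u x \<noteq> - \<infinity>" "econvex u" "lower_semicontinuous u"
    using u by (auto simp: coercive_convex_def)
  have lsc: "lower_semicontinuous (U i)" for i
    using U by (simp add: coercive_convex_def)
  have ge: "u x \<le> U i x" for i x
    using le by (meson order_trans)
  have "(\<lambda>i. LINT x|lborel. dom_comp f (U i) x) \<longlonglongrightarrow> (LINT x|lborel. dom_comp f u x)"
  proof (rule integral_dominated_convergence[where w = "dom_comp f u"])
    show "AE x in lborel. (\<lambda>i. dom_comp f (U i) x) \<longlonglongrightarrow> dom_comp f u x"
      using AE_rel_interior_edom[OF u'(2)]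
    proof eventually_elim
      case (elim x)
      show ?case
      proof (cases "x \<in> edom u")
        case True
        then show ?thesis
          using elim lim ge u'(1) by (intro dom_comp_tendsto[OF rc]) (auto simp: edom_def)
      next
        case False
        then have "U i x = \<infinity>" for i
          using ge[of x i] by (simp add: edom_def)
        then show ?thesis
          using False by (simp add: dom_comp_def edom_def)
      qed
    qed
    show "AE x in lborel. norm (dom_comp f (U i) x) \<le> dom_comp f u x" for i
      using ge u'(1) by (simp add: dom_comp_nonneg dom_comp_antimono)
  qed (use int u dom_comp_measurable u' lsc in auto)
  then show "(\<lambda>i. integral_functional f (U i)) \<longlonglongrightarrow> integral_functional f u"
    by (simp only: integral_functional_eq u'(3) lsc)
qed

end

theorem proposition6p6:
  fixes f :: "real \<Rightarrow> real"
  assumes nonneg: "\<And>t. 0 \<le> f t"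
    and decreasing: "antimono f"
    and right_continuous: "\<And>t. continuous (at_right t) f"
  shows "((\<forall>u \<in> (coercive_convex :: (real ^ 'n \<Rightarrow> ereal) set). integral_wf f u) \<longleftrightarrow>
            (\<integral>\<^sup>+ t\<in>{0..}. ennreal (t ^ (CARD('n) - 1) * f t) \<partial>lborel) < \<infinity>) \<and>
         ((\<integral>\<^sup>+ t\<in>{0..}. ennreal (t ^ (CARD('n) - 1) * f t) \<partial>lborel) < \<infinity> \<longrightarrow>
            (let \<mu> = (integral_functional f :: (real ^ 'n \<Rightarrow> ereal) \<Rightarrow> real) in
               (valuation \<mu> \<and> rigid_motion_invariant \<mu> \<and> simple_functional \<mu> \<and>
                  decreasing_functional \<mu>) \<and>
               homogeneous_functional CARD('n) \<mu> \<and>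
               m_continuous \<mu>))"
proof -
  interpret nonneg_antimono f
    by unfold_locales (fact nonneg decreasing)+
  let ?P = "(\<integral>\<^sup>+ t\<in>{0..}. ennreal (t ^ (CARD('n) - 1) * f t) \<partial>lborel) < \<infinity>"
  have P_iff: "integrable lborel (\<lambda>x::real ^ 'n. f (norm x)) \<longleftrightarrow> ?P"
    using integrable_norm_iff[where 'a = "real ^ 'n"] by simp
  have int: "integrable lborel (dom_comp f u)" if ?P "u \<in> coercive_convex" for u :: "real ^ 'n \<Rightarrow> ereal"
    using that integrable_dom_comp P_iff by blast
  have wf_iff: "integral_wf f u \<longleftrightarrow> integrable lborel (dom_comp f u)" if "u \<in> coercive_convex"
    for u :: "real ^ 'n \<Rightarrow> ereal"
    using that by (simp add: coercive_convex_def integral_wf_iff)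
  have ?P if "\<forall>u \<in> (coercive_convex :: (real ^ 'n \<Rightarrow> ereal) set). integral_wf f u"
  proof -
    have "integrable lborel (dom_comp f (\<lambda>x::real ^ 'n. ereal (norm x)))"
      using that norm_coercive_convex wf_iff by blast
    then show ?P
      unfolding P_iff[symmetric] by (simp add: dom_comp_def[abs_def])
  qed
  then show ?thesis
    using int wf_iff integral_functional_valuation integral_functional_rigid_motion_invariant
      integral_functional_simple integral_functional_decreasing integral_functional_homogeneous
      integral_functional_m_continuous[OF right_continuous]
    unfolding Let_def by blast
qed

end
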